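(* Let $\rho>0$ and let $\Theta\in\mathbb R^{n\times n}$ be a diagonal matrix with positive diagonal entries. If $\delta>0$, then the matrix $S_{\rho,\delta}=A(\Theta^{-1}+\rho I)^{-1}A^T+\delta I$ is strictly diagonally dominant, i.e. $\sum_{j\ne i}|(S_{\rho,\delta})_{ij}|<|(S_{\rho,\delta})_{ii}|$ for every $i$.
   Context: $G=(V,E)$ is a connected graph without self-loops with directed edges $E\subset V\times V$, $|V|=m$, $|E|=n$. $A\in\{-1,0,1\}^{m\times n}$ is its incidence matrix: $A_{ve}=-1$ if $e=(v,w)$ for some $w\in V$, $A_{ve}=1$ if $e=(w,v)$ for some $w\in V$, $A_{ve}=0$ otherwise. *)

theory Defs
  imports
    "Graph_Theory.Digraph_Component"
    "Jordan_Normal_Form.Gauss_Jordan_Elimination"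
begin

text \<open>
  A matrix whose rows belong to the vertices and whose columns belong to the edges
  of a digraph needs an enumeration of both. The lists \<open>vs\<close> and \<open>es\<close> provide it:
  vertex \<open>vs ! i\<close> belongs to row \<open>i\<close>, and edge \<open>es ! j\<close> to column \<open>j\<close>.
\<close>

definition enumerates :: "'a list \<Rightarrow> 'a set \<Rightarrow> bool" where
  "enumerates xs X \<longleftrightarrow> distinct xs \<and> set xs = X"

text \<open>Without self-loops, the first two cases exclude each other.\<close>

definition incidence_mat ::
  "'v pair_pre_digraph \<Rightarrow> 'v list \<Rightarrow> ('v \<times> 'v) list \<Rightarrow> real mat" where
  "incidence_mat G vs es = mat (length vs) (length es) (\<lambda>(i, j).
     if \<exists>w \<in> pverts G. es ! j = (vs ! i, w) then - 1
     else if \<exists>w \<in> pverts G. es ! j = (w, vs ! i) then 1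
     else 0)"

text \<open>The inverse of an invertible matrix; the value is unspecified for other matrices.\<close>

definition mat_inv :: "'a :: field mat \<Rightarrow> 'a mat" where
  "mat_inv M = the (mat_inverse M)"

lemma mat_inv_inverse:
  assumes M: "M \<in> carrier_mat n n" and inv: "invertible_mat M"
  shows "mat_inv M \<in> carrier_mat n n" "M * mat_inv M = 1\<^sub>m n" "mat_inv M * M = 1\<^sub>m n"
proof -
  obtain B where MB: "M * B = 1\<^sub>m n" and BM: "B * M = 1\<^sub>m (dim_row B)"
    using inv M unfolding invertible_mat_def inverts_mat_def by auto
  have "dim_col B = n" "dim_row B = n"
    using arg_cong[OF MB, of dim_col] arg_cong[OF BM, of dim_col] M by auto
  then have "B \<in> carrier_mat n n" "B * M = 1\<^sub>m n"
    using BM by auto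
  then have "M \<in> Units (ring_mat TYPE('a) n ())"
    using M MB unfolding Units_def ring_mat_def by auto
  then obtain C where "mat_inverse M = Some C"
    using mat_inverse(1)[OF M, where b = "()"] by (cases "mat_inverse M") auto
  then show "mat_inv M \<in> carrier_mat n n" "M * mat_inv M = 1\<^sub>m n" "mat_inv M * M = 1\<^sub>m n"
    using mat_inverse(2)[OF M] unfolding mat_inv_def by auto
qed

definition strictly_diagonally_dominant :: "real mat \<Rightarrow> bool" where
  "strictly_diagonally_dominant M \<longleftrightarrow> square_mat M \<and>
     (\<forall>i < dim_row M. (\<Sum>j \<in> {..<dim_col M} - {i}. \<bar>M $$ (i, j)\<bar>) < \<bar>M $$ (i, i)\<bar>)"

definition S_mat :: "real mat \<Rightarrow> real mat \<Rightarrow> real \<Rightarrow> real \<Rightarrow> real mat" where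
  "S_mat A \<Theta> \<rho> \<delta> =
     A * mat_inv (mat_inv \<Theta> + \<rho> \<cdot>\<^sub>m 1\<^sub>m (dim_row \<Theta>)) * transpose_mat A + \<delta> \<cdot>\<^sub>m 1\<^sub>m (dim_row A)"

end

theory Submission
  imports Defs "Jordan_Normal_Form.Determinant"
begin

text \<open>
  The matrix \<open>\<Theta>\<^sup>-\<^sup>1 + \<rho> I\<close> is diagonal with positive diagonal entries, and so is its inverse,
  with entries \<open>w\<^sub>e > 0\<close>, say. Hence the entries of \<open>S\<close> are
  \<open>\<Sum>\<^sub>e w\<^sub>e A\<^sub>i\<^sub>e A\<^sub>j\<^sub>e\<close>, plus \<open>\<delta>\<close> if \<open>i = j\<close>. A column of the incidence matrix of a loopfree
  digraph has exactly two nonzero entries, both of absolute value \<open>1\<close>: those of the two ends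
  of the edge. So if \<open>A\<^sub>i\<^sub>e \<noteq> 0\<close>, then the other entries of column \<open>e\<close> have absolute sum \<open>1\<close>, and
  exchanging the two sums gives
  \<open>\<Sum>\<^sub>j\<^sub>\<noteq>\<^sub>i \<bar>S\<^sub>i\<^sub>j\<bar> \<le> \<Sum>\<^sub>e w\<^sub>e \<bar>A\<^sub>i\<^sub>e\<bar> (\<Sum>\<^sub>j\<^sub>\<noteq>\<^sub>i \<bar>A\<^sub>j\<^sub>e\<bar>) \<le> \<Sum>\<^sub>e w\<^sub>e A\<^sub>i\<^sub>e\<^sup>2 = S\<^sub>i\<^sub>i - \<delta> < S\<^sub>i\<^sub>i\<close>.
  The column sums are computed in \<open>incidence_mat_col_sum\<close>; the estimate is
  \<open>strictly_diagonally_dominant_weighted_gram\<close>.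
\<close>

lemma mat_inv_eqI:
  assumes M: "M \<in> carrier_mat n n" and N: "N \<in> carrier_mat n n" and MN: "M * N = 1\<^sub>m n"
  shows "mat_inv M = N"
proof -
  have NM: "N * M = 1\<^sub>m n"
    using mat_mult_left_right_inverse[OF M N MN] .
  have "invertible_mat M"
    unfolding invertible_mat_def inverts_mat_def using M N MN NM by auto
  note inv = mat_inv_inverse[OF M this]
  have "mat_inv M = mat_inv M * (M * N)"
    using MN inv(1) by simp
  also have "\<dots> = (mat_inv M * M) * N"
    using assoc_mult_mat[OF inv(1) M N] by simp
  also have "\<dots> = N"
    using inv(3) N by simp
  finally show ?thesis .
qed

lemma mat_inv_mat_diag:
  fixes f :: "nat \<Rightarrow> 'a :: field"
  assumes "\<And>i. i < n \<Longrightarrow> f i \<noteq> 0"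
  shows "mat_inv (mat_diag n f) = mat_diag n (\<lambda>i. inverse (f i))"
proof (rule mat_inv_eqI)
  show "mat_diag n f * mat_diag n (\<lambda>i. inverse (f i)) = 1\<^sub>m n"
    unfolding mat_diag_diag using assms by (intro eq_matI) (auto simp: mat_diag_def)
qed auto

lemma diagonal_mat_eq_mat_diag:
  assumes "M \<in> carrier_mat n n" and "diagonal_mat M"
  shows "M = mat_diag n (\<lambda>i. M $$ (i, i))"
  using assms by (intro eq_matI) (auto simp: mat_diag_def diagonal_mat_def)

lemma index_mult_mat_diag_transpose:
  fixes A :: "'a :: comm_semiring_0 mat"
  assumes A: "A \<in> carrier_mat m n" and "i < m" and "j < m"
  shows "(A * mat_diag n w * transpose_mat A) $$ (i, j) = (\<Sum>e<n. w e * A $$ (i, e) * A $$ (j, e))"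
  using assms unfolding mat_diag_mult_right[OF A]
  by (auto simp: scalar_prod_def lessThan_atLeast0 ac_simps intro!: sum.cong)

text \<open>
  The hypothesis \<open>col\<close> says that in each column the absolute value of every nonzero entry is at
  least the sum of the absolute values of the others. This forces the column to have at most two nonzero entries, of equal absolute value
  if there are two.
\<close>

lemma strictly_diagonally_dominant_weighted_gram:
  fixes A :: "real mat"
  assumes A: "A \<in> carrier_mat m n"
    and w: "\<And>e. e < n \<Longrightarrow> w e \<ge> 0"
    and \<delta>: "\<delta> > 0"
    and col: "\<And>i e. i < m \<Longrightarrow> e < n \<Longrightarrow> A $$ (i, e) \<noteq> 0 \<Longrightarrow>
      (\<Sum>j\<in>{..<m} - {i}. \<bar>A $$ (j, e)\<bar>) \<le> \<bar>A $$ (i, e)\<bar>"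
  shows "strictly_diagonally_dominant (A * mat_diag n w * transpose_mat A + \<delta> \<cdot>\<^sub>m 1\<^sub>m m)"
    (is "strictly_diagonally_dominant ?S")
proof -
  have dim: "dim_row ?S = m" "dim_col ?S = m"
    using A by auto
  have entry: "?S $$ (i, j) = (\<Sum>e<n. w e * A $$ (i, e) * A $$ (j, e)) + (if i = j then \<delta> else 0)"
    if "i < m" "j < m" for i j
    using that A index_mult_mat_diag_transpose[OF A that, of w] by simp
  have "(\<Sum>j\<in>{..<m} - {i}. \<bar>?S $$ (i, j)\<bar>) < \<bar>?S $$ (i, i)\<bar>" if i: "i < m" for i
  proof -
    have "(\<Sum>j\<in>{..<m} - {i}. \<bar>?S $$ (i, j)\<bar>)
        \<le> (\<Sum>j\<in>{..<m} - {i}. \<Sum>e<n. w e * \<bar>A $$ (i, e)\<bar> * \<bar>A $$ (j, e)\<bar>)"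
    proof (rule sum_mono)
      fix j assume j: "j \<in> {..<m} - {i}"
      have "\<bar>?S $$ (i, j)\<bar> = \<bar>\<Sum>e<n. w e * A $$ (i, e) * A $$ (j, e)\<bar>"
        using entry[of i j] i j by auto
      also have "\<dots> \<le> (\<Sum>e<n. \<bar>w e * A $$ (i, e) * A $$ (j, e)\<bar>)"
        by (rule sum_abs)
      also have "\<dots> = (\<Sum>e<n. w e * \<bar>A $$ (i, e)\<bar> * \<bar>A $$ (j, e)\<bar>)"
        using w by (intro sum.cong) (auto simp: abs_mult)
      finally show "\<bar>?S $$ (i, j)\<bar> \<le> (\<Sum>e<n. w e * \<bar>A $$ (i, e)\<bar> * \<bar>A $$ (j, e)\<bar>)" .
    qed
    also have "\<dots> = (\<Sum>e<n. w e * \<bar>A $$ (i, e)\<bar> * (\<Sum>j\<in>{..<m} - {i}. \<bar>A $$ (j, e)\<bar>))"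
      by (subst sum.swap) (simp add: sum_distrib_left)
    also have "\<dots> \<le> (\<Sum>e<n. w e * \<bar>A $$ (i, e)\<bar> * \<bar>A $$ (i, e)\<bar>)"
    proof (rule sum_mono)
      fix e assume "e \<in> {..<n}"
      then show "w e * \<bar>A $$ (i, e)\<bar> * (\<Sum>j\<in>{..<m} - {i}. \<bar>A $$ (j, e)\<bar>)
          \<le> w e * \<bar>A $$ (i, e)\<bar> * \<bar>A $$ (i, e)\<bar>"
        using w[of e] col[OF i, of e]
        by (cases "A $$ (i, e) = 0") (auto intro: mult_left_mono)
    qed
    also have "\<dots> = ?S $$ (i, i) - \<delta>"
      using entry[OF i i] by (simp add: mult.assoc)
    also have "\<dots> < \<bar>?S $$ (i, i)\<bar>"
      using \<delta> by linarith
    finally show ?thesis .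
  qed
  then show ?thesis
    unfolding strictly_diagonally_dominant_def using dim by simp
qed

lemma incidence_mat_col_sum:
  assumes G: "pair_digraph G"
    and vs: "enumerates vs (pverts G)" and es: "enumerates es (parcs G)"
    and i: "i < length vs" and e: "e < length es"
    and nz: "incidence_mat G vs es $$ (i, e) \<noteq> 0"
  shows "(\<Sum>j\<in>{..<length vs} - {i}. \<bar>incidence_mat G vs es $$ (j, e)\<bar>)
    = \<bar>incidence_mat G vs es $$ (i, e)\<bar>"
proof -
  interpret pair_digraph G by (fact G)
  have vs': "distinct vs" "set vs = pverts G" and es': "set es = parcs G"
    using vs es by (auto simp: enumerates_def)
  obtain u v where uv: "es ! e = (u, v)"
    by (cases "es ! e")
  then have arc: "(u, v) \<in> parcs G"
    using e es' nth_mem by metis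
  then have mem: "u \<in> pverts G" "v \<in> pverts G" and "u \<noteq> v"
    using arc_fst_in_verts arc_snd_in_verts pair_no_loops by force+
  then obtain a b where ab: "a < length vs" "vs ! a = u" "b < length vs" "vs ! b = v" "a \<noteq> b"
    using vs'(2) by (metis in_set_conv_nth)
  have entry: "\<bar>incidence_mat G vs es $$ (j, e)\<bar> = (if j \<in> {a, b} then 1 else 0)"
    if j: "j < length vs" for j
  proof -
    have "u = vs ! j \<longleftrightarrow> j = a" "v = vs ! j \<longleftrightarrow> j = b"
      using ab j vs'(1) nth_eq_iff_index_eq by blast+
    then show ?thesis
      using j e mem by (auto simp: incidence_mat_def uv)
  qed
  have iab: "i \<in> {a, b}"
    using entry[OF i] nz by (auto split: if_splits)
  have "(\<Sum>j\<in>{..<length vs} - {i}. \<bar>incidence_mat G vs es $$ (j, e)\<bar>)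
      = (\<Sum>j\<in>{..<length vs} - {i}. if j \<in> {a, b} then 1 else 0)"
    by (rule sum.cong) (auto simp: entry)
  also have "\<dots> = real (card (({..<length vs} - {i}) \<inter> {a, b}))"
    by (subst sum.inter_restrict[symmetric]) auto
  also have "({..<length vs} - {i}) \<inter> {a, b} = {a, b} - {i}"
    using ab by auto
  also have "card ({a, b} - {i}) = 1"
    using iab \<open>a \<noteq> b\<close> by auto
  finally show ?thesis
    using entry[OF i] iab by simp
qed

theorem lemma3:
  fixes G :: "'v pair_pre_digraph"
    and vs :: "'v list" and es :: "('v \<times> 'v) list"
    and m n :: nat and A \<Theta> :: "real mat" and \<rho> \<delta> :: real
  assumes "pair_digraph G" and "connected (with_proj G)"
    and "card (pverts G) = m" and "card (parcs G) = n"
    and "enumerates vs (pverts G)" and "enumerates es (parcs G)"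
    and "A = incidence_mat G vs es"
    and "\<rho> > 0"
    and "\<Theta> \<in> carrier_mat n n" and "diagonal_mat \<Theta>" and "\<And>i. i < n \<Longrightarrow> \<Theta> $$ (i, i) > 0"
    and "\<delta> > 0"
  shows "strictly_diagonally_dominant (S_mat A \<Theta> \<rho> \<delta>)"
proof -
  have lens: "length vs = m" "length es = n"
    using assms(3-6) distinct_card unfolding enumerates_def by metis+
  have A: "A \<in> carrier_mat m n"
    using assms(7) lens by (simp add: incidence_mat_def)
  define w where "w = (\<lambda>e. inverse (inverse (\<Theta> $$ (e, e)) + \<rho>))"
  have pos: "inverse (\<Theta> $$ (e, e)) + \<rho> > 0" if "e < n" for e
    using assms(8) assms(11)[OF that] by (simp add: add_pos_pos)
  have "mat_inv \<Theta> = mat_diag n (\<lambda>e. inverse (\<Theta> $$ (e, e)))"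
    using mat_inv_mat_diag[of n "\<lambda>e. \<Theta> $$ (e, e)"] assms(11)
      diagonal_mat_eq_mat_diag[OF assms(9,10)] by fastforce
  then have "mat_inv \<Theta> + \<rho> \<cdot>\<^sub>m 1\<^sub>m n = mat_diag n (\<lambda>e. inverse (\<Theta> $$ (e, e)) + \<rho>)"
    by (auto simp: mat_diag_def)
  then have "mat_inv (mat_inv \<Theta> + \<rho> \<cdot>\<^sub>m 1\<^sub>m n) = mat_diag n w"
    using mat_inv_mat_diag[of n "\<lambda>e. inverse (\<Theta> $$ (e, e)) + \<rho>"] pos
    unfolding w_def by fastforce
  then have "S_mat A \<Theta> \<rho> \<delta> = A * mat_diag n w * transpose_mat A + \<delta> \<cdot>\<^sub>m 1\<^sub>m m"
    using A assms(9) by (simp add: S_mat_def)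
  moreover have "strictly_diagonally_dominant \<dots>"
  proof (rule strictly_diagonally_dominant_weighted_gram[OF A _ assms(12)])
    show "w e \<ge> 0" if "e < n" for e
      using pos[OF that] by (simp add: w_def)
    show "(\<Sum>j\<in>{..<m} - {i}. \<bar>A $$ (j, e)\<bar>) \<le> \<bar>A $$ (i, e)\<bar>"
      if "i < m" "e < n" "A $$ (i, e) \<noteq> 0" for i e
      using incidence_mat_col_sum[OF assms(1,5,6), of i e] that lens assms(7) by simp
  qed
  ultimately show ?thesis by simp
qed

end
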